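(* Let $k\ge 1$. Then the HAL-regularized $k$-th order TMLE satisfies the exact expansion \[ \begin{aligned} \Psi(P_n^{k,(1),*})-\Psi(P_0) &=\Psi(\tilde P_n^{(1)}\circ\cdots\circ\tilde P_n^{(k)}(P_n^0))-\Psi(P_0)\\ &=\sum_{j=0}^{k-2}\Big\{(P_n-P_0)D^{(j+1)}_{n,\tilde P_n^{(j+1)}(P_0)}+R_n^{(j+1)}(\tilde P_n^{(j+1)}(P_0),P_0)\Big\}\\ &\quad+(P_n-P_0)D^{(k)}_{n,\tilde P_n^{(k)}(P_n^0)}+R_n^{(k)}(\tilde P_n^{(k)}(P_n^0),P_0)\\ &\quad-\sum_{j=0}^{k-2}P_nD^{(j+1)}_{n,\tilde P_n^{(j+1)}(P_0)}-P_nD^{(k)}_{n,\tilde P_n^{(k)}(P_n^0)} . \end{aligned} \] For any of the canonical gradient terms in this expansion one may replace $P_n$ by $\tilde P_n$ (simultaneously in its $(P_n-P_0)$-term and in the corresponding subtracted $P_n$-term). Moreover, suppose $k\ge 2$ and that \[ E_n\equiv-\sum_{j=1}^{k-1}\tilde P_nD^{(j)}_{n,\tilde P_n^{(j)}(P_0)}-\tilde P_nD^{(k)}_{n,\tilde P_n^{(k)}(P_n^0)}=0 \] (which can be arranged by defining $\epsilon_n^{(j)}(P)$ as a solution in $\epsilon$ of $\tilde P_nD^{(j)}_{n,\tilde P_n^{(j)}(P,\epsilon)}=0$). Then \[ \begin{aligned} \Psi(P_n^{k,(1),*})-\Psi(P_0)&=(P_n-P_0)D^{(1)}_{\tilde P_n^{(1)}(P_0)}+R^{(1)}(\tilde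 P_n^{(1)}(P_0),P_0)\\ &\quad+\sum_{j=1}^{k-2}\Big\{(\tilde P_n-P_0)D^{(j+1)}_{n,\tilde P_n^{(j+1)}(P_0)}+R_n^{(j+1)}(\tilde P_n^{(j+1)}(P_0),P_0)\Big\}\\ &\quad+(\tilde P_n-P_0)D^{(k)}_{n,\tilde P_n^{(k)}(P_n^0)}+R_n^{(k)}(\tilde P_n^{(k)}(P_n^0),P_0)\\ &\quad+(\tilde P_n-P_n)D^{(1)}_{\tilde P_n^{(1)}(P_0)} . \end{aligned} \]
   Context: $O_1,\dots,O_n$ are i.i.d. from $P_0\in{\cal M}$, where the model ${\cal M}$ is a set of probability distributions dominated by a measure $\mu$ (densities $p=dP/d\mu$). $P_n$ is the empirical measure; $Pf=\int f\,dP$ for a (signed) measure $P$. $L(P)=-\log p$. A functional $\Phi:{\cal M}\to\mathbb R$ is pathwise differentiable at $P$ with canonical gradient $D_P$ if for every path $\{P_{\delta,h}\}\subset{\cal M}$ in a given class, through $P$ at $\delta=0$ with score $h$, $\frac{d}{d\delta}\Phi(P_{\delta,h})|_{\delta=0}=P D_Ph$, with $D_P$ in the tangent space $T_P({\cal M})\subset L^2_0(P)$ (closure of the linear span of the scores; $L_0^2(P)$ is the space of mean zero square integrable functions). In particular $PD_P=0$. $\Psi:{\cal M}\to\mathbb R$ is pathwise differentiable with canonical gradient $D^{(1)}_P$. $\tilde P_n\in{\cal M}$ is the HAL-MLE: a data-dependent maximum likelihood estimator of $P_0$ over the elements of ${\cal M}$ for which the cadlag function parametrizing the density has variation norm bounded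 by a constant; $d\tilde P_n/dP$ is assumed to exist at all $P$ used. Recursively, put $\Psi_n^{(0)}=\Psi$, $D^{(1)}_{n,P}=D^{(1)}_P$. For $j\ge1$: $D^{(j)}_{n,P}$ is the canonical gradient of $\Psi_n^{(j-1)}$ at $P$; $\{\tilde P_n^{(j)}(P,\epsilon):\epsilon\}\subset{\cal M}$ is a least favorable path through $P$ at $\epsilon=0$ whose scores at $\epsilon=0$ span $D^{(j)}_{n,P}$; $\epsilon_n^{(j)}(P)$ is either $\arg\min_\epsilon\tilde P_nL(\tilde P_n^{(j)}(P,\epsilon))$ or a solution of $\tilde P_nD^{(j)}_{n,\tilde P_n^{(j)}(P,\epsilon)}=0$; $\tilde P_n^{(j)}(P)=\tilde P_n^{(j)}(P,\epsilon_n^{(j)}(P))$ is the HAL-regularized TMLE update; and $\Psi_n^{(j)}(P)=\Psi_n^{(j-1)}(\tilde P_n^{(j)}(P))$. The exact remainder is $R_n^{(j)}(P,P')=\Psi_n^{(j-1)}(P)-\Psi_n^{(j-1)}(P')+P'D^{(j)}_{n,P}$, and $R^{(1)}=R_n^{(1)}$. All these objects are assumed to exist at the distributions where they are used. $P_n^0\in{\cal M}$ is an initial estimator, and $P_n^{k,(1),*}=\tilde P_n^{(1)}\circ\cdots\circ\tilde P_n^{(k)}(P_n^0)$. Empty sums are zero. *)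

theory Defs
  imports "HOL-Probability.Probability"
begin

section \<open>Multivariate cadlag functions and the sectional variation norm\<close>

text \<open>
  A function on the cube \<open>[0, \<tau>]\<close> is cadlag if at every point it has a limit from each of the
  \<open>2\<^sup>d\<close> quadrants and agrees with the limit from the upper right one.
\<close>

definition quadrant :: "'d::finite set \<Rightarrow> real ^ 'd \<Rightarrow> (real ^ 'd) set" where
  "quadrant s t = {u. \<forall>i. if i \<in> s then u $ i < t $ i else t $ i \<le> u $ i}"

definition cadlag :: "real ^ 'd::finite \<Rightarrow> (real ^ 'd \<Rightarrow> real) \<Rightarrow> bool" where
  "cadlag \<tau> f \<longleftrightarrow> (\<forall>t\<in>cbox 0 \<tau>.
     (\<forall>s. \<exists>l. (f \<longlongrightarrow> l) (at t within quadrant s t \<inter> cbox 0 \<tau>)) \<and>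
     (f \<longlongrightarrow> f t) (at t within quadrant {} t \<inter> cbox 0 \<tau>))"

text \<open>
  A grid consists of a number \<open>N\<close> and, for every coordinate, points
  \<open>0 = g i 0 \<le> \<dots> \<le> g i N = \<tau> $ i\<close>; repeated points contribute nothing below, so
  a common \<open>N\<close> is no restriction.
\<close>

definition grids :: "real ^ 'd::finite \<Rightarrow> (nat \<times> ('d \<Rightarrow> nat \<Rightarrow> real)) set" where
  "grids \<tau> = {(N, g). \<forall>i. g i 0 = 0 \<and> g i N = \<tau> $ i \<and> (\<forall>m<N. g i m \<le> g i (Suc m))}"

text \<open>
  The increment over the cell with index \<open>m\<close> of the section of \<open>f\<close> in which the
  coordinates outside \<open>s\<close> are set to zero.
\<close>

definition section_increment ::
  "(real ^ 'd::finite \<Rightarrow> real) \<Rightarrow> 'd set \<Rightarrow> ('d \<Rightarrow> nat \<Rightarrow> real) \<Rightarrow> ('d \<Rightarrow> nat) \<Rightarrow> real" where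
  "section_increment f s g m =
     (\<Sum>r\<in>Pow s. (- 1) ^ card (s - r) *
        f (\<chi> i. if i \<in> r then g i (Suc (m i)) else if i \<in> s then g i (m i) else 0))"

text \<open>
  The (Vitali) variation of the section; for right-continuous \<open>f\<close> it is the total mass
  \<open>\<integral>\<bar>d f\<^sub>s\<bar>\<close> over \<open>(0\<^sub>s, \<tau>\<^sub>s]\<close>. For \<open>s = {}\<close> it is \<open>\<bar>f 0\<bar>\<close>.
\<close>

definition section_variation :: "real ^ 'd::finite \<Rightarrow> (real ^ 'd \<Rightarrow> real) \<Rightarrow> 'd set \<Rightarrow> ennreal" where
  "section_variation \<tau> f s =
     (SUP (N, g)\<in>grids \<tau>. \<Sum>m\<in>Pi\<^sub>E s (\<lambda>_. {..<N}). ennreal \<bar>section_increment f s g m\<bar>)"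

definition variation_norm :: "real ^ 'd::finite \<Rightarrow> (real ^ 'd \<Rightarrow> real) \<Rightarrow> ennreal" where
  "variation_norm \<tau> f = (\<Sum>s\<in>UNIV. section_variation \<tau> f s)"


section \<open>Models, scores, tangent spaces, canonical gradients\<close>

text \<open>
  The density of \<open>P\<close> is \<open>param_density S (cadlag_param S P)\<close>; fixing it as a function gives
  meaning to its value at a data point. The last field is, for every \<open>P\<close>, the given class
  of paths through \<open>P\<close>; only the values of a path near 0 matter.
\<close>

record ('o, 'd) stat_model =
  base_measure :: "'o measure"
  laws :: "'o measure set"
  upper_corner :: "real ^ 'd"
  cadlag_param :: "'o measure \<Rightarrow> real ^ 'd \<Rightarrow> real"
  param_density :: "(real ^ 'd \<Rightarrow> real) \<Rightarrow> 'o \<Rightarrow> real"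
  path_class :: "'o measure \<Rightarrow> (real \<Rightarrow> 'o measure) set"

definition pdens :: "('o, 'd::finite) stat_model \<Rightarrow> 'o measure \<Rightarrow> 'o \<Rightarrow> real" where
  "pdens S P = param_density S (cadlag_param S P)"

definition L2_zero :: "'o measure \<Rightarrow> ('o \<Rightarrow> real) set" where
  "L2_zero P = {f \<in> borel_measurable P. integrable P (\<lambda>y. (f y)\<^sup>2) \<and> (\<integral>y. f y \<partial>P) = 0}"

definition has_score ::
  "('o, 'd::finite) stat_model \<Rightarrow> 'o measure \<Rightarrow> (real \<Rightarrow> 'o measure) \<Rightarrow> ('o \<Rightarrow> real) \<Rightarrow> bool" where
  "has_score S P \<gamma> h \<longleftrightarrow>
     h \<in> L2_zero P \<and> \<gamma> 0 = P \<and> (\<forall>\<^sub>F \<delta> in nhds 0. \<gamma> \<delta> \<in> laws S) \<and>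
     (AE y in P. (\<forall>\<^sub>F \<delta> in nhds 0. 0 < pdens S (\<gamma> \<delta>) y) \<and>
        ((\<lambda>\<delta>. ln (pdens S (\<gamma> \<delta>) y)) has_real_derivative h y) (at 0))"

definition stat_model :: "('o, 'd::finite) stat_model \<Rightarrow> bool" where
  "stat_model S \<longleftrightarrow>
     (\<forall>i. 0 < upper_corner S $ i) \<and>
     (\<forall>P\<in>laws S. prob_space P \<and> cadlag (upper_corner S) (cadlag_param S P) \<and>
        pdens S P \<in> borel_measurable (base_measure S) \<and>
        (\<forall>y\<in>space (base_measure S). 0 \<le> pdens S P y) \<and>
        P = density (base_measure S) (\<lambda>y. ennreal (pdens S P y)) \<and>
        (\<forall>\<gamma>\<in>path_class S P. \<exists>h. has_score S P \<gamma> h))"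

definition tangent_space :: "('o, 'd::finite) stat_model \<Rightarrow> 'o measure \<Rightarrow> ('o \<Rightarrow> real) set" where
  "tangent_space S P = {f \<in> L2_zero P. \<forall>e>0. \<exists>H c. finite H \<and>
     (\<forall>h\<in>H. \<exists>\<gamma>\<in>path_class S P. has_score S P \<gamma> h) \<and>
     (\<integral>y. (f y - (\<Sum>h\<in>H. c h * h y))\<^sup>2 \<partial>P) < e}"

definition canonical_gradient ::
  "('o, 'd::finite) stat_model \<Rightarrow> ('o measure \<Rightarrow> real) \<Rightarrow> 'o measure \<Rightarrow> ('o \<Rightarrow> real) \<Rightarrow> bool" where
  "canonical_gradient S \<Phi> P D \<longleftrightarrow> D \<in> tangent_space S P \<and>
     (\<forall>\<gamma>\<in>path_class S P. \<forall>h. has_score S P \<gamma> h \<longrightarrow>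
        ((\<lambda>\<delta>. \<Phi> (\<gamma> \<delta>)) has_real_derivative (\<integral>y. D y * h y \<partial>P)) (at 0))"


section \<open>Log-likelihood loss and the HAL-MLE\<close>

definition log_loss :: "('o, 'd::finite) stat_model \<Rightarrow> 'o measure \<Rightarrow> 'o \<Rightarrow> ereal" where
  "log_loss S P y = (if 0 < pdens S P y then ereal (- ln (pdens S P y)) else \<infinity>)"

text \<open>
  The integral of an extended real function; by \<open>\<infinity> - \<infinity> = \<infinity>\<close> in \<^typ>\<open>ereal\<close>, a function
  whose positive and negative parts both have infinite integral cannot be a minimiser below.
\<close>

definition risk :: "'o measure \<Rightarrow> ('o \<Rightarrow> ereal) \<Rightarrow> ereal" where
  "risk Q f = enn2ereal (\<integral>\<^sup>+ y. e2ennreal (f y) \<partial>Q) - enn2ereal (\<integral>\<^sup>+ y. e2ennreal (- f y) \<partial>Q)"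

definition empirical_measure :: "'o measure \<Rightarrow> nat \<Rightarrow> (nat \<Rightarrow> 'o) \<Rightarrow> 'o measure" where
  "empirical_measure \<mu> n x = distr (uniform_count_measure {..<n}) \<mu> x"

definition hal_mle ::
  "('o, 'd::finite) stat_model \<Rightarrow> real \<Rightarrow> 'o measure \<Rightarrow> 'o measure \<Rightarrow> bool" where
  "hal_mle S C Pn Q \<longleftrightarrow>
     is_arg_min (\<lambda>P. risk Pn (log_loss S P))
       (\<lambda>P. P \<in> laws S \<and> variation_norm (upper_corner S) (cadlag_param S P) \<le> ennreal C) Q"


section \<open>HAL-regularized higher order TMLE\<close>

text \<open>
  The data-dependent objects: the HAL-MLE, the initial estimator, and, for every order \<open>j\<close> and
  distribution \<open>P\<close>, the canonical gradient at \<open>P\<close>, the least favorable path through \<open>P\<close> with its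
  parameter set, and the selected value of its parameter. The set \<open>update_domain A j\<close> consists of
  distributions at which the order \<open>j\<close> update is available (by convention all of the model for
  \<open>j = 0\<close>), so that it is contained in the domain of the functional of order \<open>j\<close>.
\<close>

record ('o, 'e) ho_tmle =
  hal :: "'o measure"
  initial :: "'o measure"
  grad :: "nat \<Rightarrow> 'o measure \<Rightarrow> 'o \<Rightarrow> real"
  lf_path :: "nat \<Rightarrow> 'o measure \<Rightarrow> 'e \<Rightarrow> 'o measure"
  path_param :: "nat \<Rightarrow> 'o measure \<Rightarrow> 'e set"
  eps :: "nat \<Rightarrow> 'o measure \<Rightarrow> 'e"
  update_domain :: "nat \<Rightarrow> 'o measure set"

definition update :: "('o, 'e::euclidean_space) ho_tmle \<Rightarrow> nat \<Rightarrow> 'o measure \<Rightarrow> 'o measure" where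
  "update A j P = lf_path A j P (eps A j P)"

primrec ho_functional ::
  "('o measure \<Rightarrow> real) \<Rightarrow> ('o, 'e::euclidean_space) ho_tmle \<Rightarrow> nat \<Rightarrow> 'o measure \<Rightarrow> real" where
  "ho_functional \<Psi> A 0 P = \<Psi> P"
| "ho_functional \<Psi> A (Suc j) P = ho_functional \<Psi> A j (update A (Suc j) P)"

definition remainder ::
  "('o measure \<Rightarrow> real) \<Rightarrow> ('o, 'e::euclidean_space) ho_tmle \<Rightarrow> nat \<Rightarrow> 'o measure \<Rightarrow> 'o measure \<Rightarrow> real"
  where
  "remainder \<Psi> A j P P' =
     ho_functional \<Psi> A (j - 1) P - ho_functional \<Psi> A (j - 1) P' + (\<integral>y. grad A j P y \<partial>P')"

text \<open>
  The scores at 0 of a path with a multidimensional parameter are those of its one-dimensional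
  subpaths \<open>t \<mapsto> \<pi> (t v)\<close>.
\<close>

definition least_favorable_path ::
  "('o, 'd::finite) stat_model \<Rightarrow> 'o measure \<Rightarrow> 'e::euclidean_space set \<Rightarrow> ('e \<Rightarrow> 'o measure)
     \<Rightarrow> ('o \<Rightarrow> real) \<Rightarrow> bool" where
  "least_favorable_path S P E \<pi> D \<longleftrightarrow>
     0 \<in> E \<and> \<pi> 0 = P \<and> \<pi> ` E \<subseteq> laws S \<and>
     (\<exists>V h c. finite V \<and>
        (\<forall>v\<in>V. (\<forall>\<^sub>F t in nhds 0. t *\<^sub>R v \<in> E) \<and> has_score S P (\<lambda>t. \<pi> (t *\<^sub>R v)) (h v)) \<and>
        (AE y in P. D y = (\<Sum>v\<in>V. c v * h v y)))"

text \<open>Integrability is required here because the integral of a non-integrable function is 0.\<close>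

definition solves_score_equation :: "('o, 'e::euclidean_space) ho_tmle \<Rightarrow> nat \<Rightarrow> 'o measure \<Rightarrow> bool" where
  "solves_score_equation A j P \<longleftrightarrow>
     integrable (hal A) (grad A j (lf_path A j P (eps A j P))) \<and>
     (\<integral>y. grad A j (lf_path A j P (eps A j P)) y \<partial>hal A) = 0"

definition minimizes_risk ::
  "('o, 'd::finite) stat_model \<Rightarrow> ('o, 'e::euclidean_space) ho_tmle \<Rightarrow> nat \<Rightarrow> 'o measure \<Rightarrow> bool" where
  "minimizes_risk S A j P \<longleftrightarrow>
     is_arg_min (\<lambda>\<epsilon>. risk (hal A) (log_loss S (lf_path A j P \<epsilon>))) (\<lambda>\<epsilon>. \<epsilon> \<in> path_param A j P) (eps A j P)"

definition ho_tmle ::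
  "('o, 'd::finite) stat_model \<Rightarrow> ('o measure \<Rightarrow> real) \<Rightarrow> ('o measure \<Rightarrow> 'o \<Rightarrow> real)
     \<Rightarrow> nat \<Rightarrow> ('o, 'e::euclidean_space) ho_tmle \<Rightarrow> bool" where
  "ho_tmle S \<Psi> D1 k A \<longleftrightarrow>
     initial A \<in> laws S \<and>
     (\<forall>P\<in>laws S. grad A 1 P = D1 P) \<and>
     update_domain A 0 = laws S \<and>
     (\<forall>j\<in>{1..k}. \<forall>P\<in>update_domain A j.
        P \<in> laws S \<and>
        update A j P \<in> update_domain A (j - 1) \<and>
        (\<forall>Q\<in>{P, update A j P}.
           absolutely_continuous Q (hal A) \<and>
           (\<forall>\<gamma>\<in>path_class S Q. \<forall>\<^sub>F \<delta> in nhds 0. \<gamma> \<delta> \<in> update_domain A (j - 1)) \<and>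
           canonical_gradient S (ho_functional \<Psi> A (j - 1)) Q (grad A j Q)) \<and>
        least_favorable_path S P (path_param A j P) (lf_path A j P) (grad A j P) \<and>
        eps A j P \<in> path_param A j P \<and>
        (minimizes_risk S A j P \<or> solves_score_equation A j P))"

definition kth_order_tmle :: "('o, 'e::euclidean_space) ho_tmle \<Rightarrow> nat \<Rightarrow> 'o measure" where
  "kth_order_tmle A k = foldr (update A) [1..<Suc k] (initial A)"

text \<open>The integral of \<open>f\<close> with respect to the signed measure \<open>P - Q\<close>.\<close>

definition diff_integral :: "'o measure \<Rightarrow> 'o measure \<Rightarrow> ('o \<Rightarrow> real) \<Rightarrow> real" where
  "diff_integral P Q f = (\<integral>y. f y \<partial>P) - (\<integral>y. f y \<partial>Q)"

definition score_residual :: "('o, 'e::euclidean_space) ho_tmle \<Rightarrow> 'o measure \<Rightarrow> nat \<Rightarrow> real" where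
  "score_residual A P0 k =
     - (\<Sum>j = 1..k - 1. \<integral>y. grad A j (update A j P0) y \<partial>hal A)
     - (\<integral>y. grad A k (update A k (initial A)) y \<partial>hal A)"

end

theory Submission
  imports Defs
begin

text \<open>
  Write \<open>F\<^sub>j\<close> for the functional of order \<open>j\<close>, \<open>U\<^sub>j\<close> for the update of order \<open>j\<close>, and \<open>P\<^sub>n\<^sup>0\<close> for
  the initial estimator. The expansion rests on two observations.

  By definition \<open>F\<^sub>j (U\<^sub>j\<^sub>+\<^sub>1 P) = F\<^sub>j\<^sub>+\<^sub>1 P\<close>. Up to the mean of a gradient under \<open>P0\<close>, the exact
  remainder \<open>R\<^sub>j\<^sub>+\<^sub>1 (U\<^sub>j\<^sub>+\<^sub>1 P0, P0)\<close> is therefore the change of order \<open>F\<^sub>j\<^sub>+\<^sub>1 P0 - F\<^sub>j P0\<close>. Summed over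
  \<open>j < k - 1\<close> these changes telescope to \<open>F\<^sub>k\<^sub>-\<^sub>1 P0 - \<Psi> P0\<close>. In the same way the remainder of order
  \<open>k\<close>, at the updated initial estimator, contributes \<open>F\<^sub>k P\<^sub>n\<^sup>0 - F\<^sub>k\<^sub>-\<^sub>1 P0\<close>, and \<open>F\<^sub>k P\<^sub>n\<^sup>0\<close> is the value
  of \<open>\<Psi>\<close> at the TMLE (\<open>ho_functional_eq_foldr_update\<close>).

  For every measure \<open>M\<close>, \<open>(M - P0) D - M D = - P0 D\<close>, which cancels the mean of the gradient in the
  remainder. Since \<open>M\<close> has dropped out, it may be the empirical measure or the HAL-MLE, chosen
  separately for every order: lemma \<open>tmle_expansion\<close> is stated for an arbitrary family of measures,
  and it contains the first expansion and all of the replacements. With the HAL-MLE at all orders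
  the subtracted terms add up to the score residual. When that residual is zero only the centred
  terms are left, and splitting \<open>(hal - P0) D\<^sub>1\<close> at the empirical measure gives the last claim.
\<close>

lemma ho_functional_eq_foldr_update:
  "ho_functional \<Psi> A k P = \<Psi> (foldr (update A) [1..<Suc k] P)"
  by (induction k arbitrary: P) simp_all

lemma remainder_update:
  "remainder \<Psi> A (Suc j) (update A (Suc j) P) P' =
     ho_functional \<Psi> A (Suc j) P - ho_functional \<Psi> A j P'
       + (\<integral>y. grad A (Suc j) (update A (Suc j) P) y \<partial>P')"
  by (simp add: remainder_def)

text \<open>
  The measure \<open>M\<close> occurs in both terms on the left and cancels: this is why it may be replaced freely
  in the expansion.
\<close>

lemma gradient_terms_plus_remainder:
  "diff_integral M P' (grad A (Suc j) (update A (Suc j) P))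
     + remainder \<Psi> A (Suc j) (update A (Suc j) P) P'
     - (\<integral>y. grad A (Suc j) (update A (Suc j) P) y \<partial>M) =
   ho_functional \<Psi> A (Suc j) P - ho_functional \<Psi> A j P'"
  unfolding remainder_update diff_integral_def by simp

text \<open>
  The steps at \<open>P0\<close> telescope from order \<open>0\<close> to order \<open>k - 1\<close>; the last step goes from \<open>P0\<close> at order
  \<open>k - 1\<close> to the initial estimator at order \<open>k\<close>.
\<close>

lemma tmle_expansion:
  assumes "1 \<le> k"
  shows "\<Psi> (kth_order_tmle A k) - \<Psi> P0 =
        (\<Sum>j<k - 1. diff_integral (M (j + 1)) P0 (grad A (j + 1) (update A (j + 1) P0)) +
                    remainder \<Psi> A (j + 1) (update A (j + 1) P0) P0)
        + diff_integral (M k) P0 (grad A k (update A k (initial A)))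
        + remainder \<Psi> A k (update A k (initial A)) P0
        - (\<Sum>j<k - 1. \<integral>y. grad A (j + 1) (update A (j + 1) P0) y \<partial>M (j + 1))
        - (\<integral>y. grad A k (update A k (initial A)) y \<partial>M k)"
    (is "_ = ?steps + ?grad_k + ?rem_k - ?means - ?mean_k")
proof -
  from assms obtain m where k: "k = Suc m"
    by (cases k) auto
  have "?steps - ?means = (\<Sum>j<m. ho_functional \<Psi> A (Suc j) P0 - ho_functional \<Psi> A j P0)"
    unfolding k sum_subtractf [symmetric]
    by (rule sum.cong) (simp_all only: diff_Suc_1 Suc_eq_plus1 [symmetric] gradient_terms_plus_remainder)
  also have "\<dots> = ho_functional \<Psi> A m P0 - \<Psi> P0"
    using sum_lessThan_telescope [of "\<lambda>j. ho_functional \<Psi> A j P0" m] by simp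
  finally have "?steps - ?means = ho_functional \<Psi> A m P0 - \<Psi> P0" .
  moreover have "?grad_k + ?rem_k - ?mean_k = \<Psi> (kth_order_tmle A k) - ho_functional \<Psi> A m P0"
    unfolding k gradient_terms_plus_remainder kth_order_tmle_def
    by (simp only: ho_functional_eq_foldr_update)
  ultimately show ?thesis
    by linarith
qed

lemma score_residual_eq_0:
  assumes "\<forall>j\<in>{1..k - 1}. solves_score_equation A j P0" "solves_score_equation A k (initial A)"
  shows "score_residual A P0 k = 0"
  using assms by (simp add: score_residual_def solves_score_equation_def update_def)

theorem theorem1:
  fixes S :: "('o, 'd::finite) stat_model"
    and \<Psi> :: "'o measure \<Rightarrow> real" and D1 :: "'o measure \<Rightarrow> 'o \<Rightarrow> real"
    and P0 Pn :: "'o measure"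
    and \<Omega> :: "'w measure" and X :: "nat \<Rightarrow> 'w \<Rightarrow> 'o" and \<omega> :: 'w and x :: "nat \<Rightarrow> 'o"
    and T :: "(nat \<Rightarrow> 'o) \<Rightarrow> ('o, 'e::euclidean_space) ho_tmle" and A :: "('o, 'e) ho_tmle"
    and C :: real and n k :: nat
  assumes model: "stat_model S" "P0 \<in> laws S"
    and differentiable: "\<forall>P\<in>laws S. canonical_gradient S \<Psi> P (D1 P)"
    and sample: "prob_space \<Omega>" "1 \<le> n"
      "prob_space.indep_vars \<Omega> (\<lambda>_. base_measure S) X {..<n}"
      "\<forall>i<n. distr \<Omega> (base_measure S) (X i) = P0"
    and data: "\<omega> \<in> space \<Omega>" "x = (\<lambda>i\<in>{..<n}. X i \<omega>)"
      "Pn = empirical_measure (base_measure S) n x"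
    and k: "1 \<le> k"
    and tmle: "A = T x" "hal_mle S C Pn (hal A)" "ho_tmle S \<Psi> D1 k A"
    and used: "initial A \<in> update_domain A k" "\<forall>j\<in>{1..<k}. P0 \<in> update_domain A j"
    and integrable: "\<forall>Q\<in>{P0, hal A}. (\<forall>j\<in>{1..<k}. integrable Q (grad A j (update A j P0))) \<and>
      integrable Q (grad A k (update A k (initial A)))"
  shows
    "(\<Psi> (kth_order_tmle A k) - \<Psi> P0 = \<Psi> (foldr (update A) [1..<Suc k] (initial A)) - \<Psi> P0 \<and>
      \<Psi> (kth_order_tmle A k) - \<Psi> P0 =
        (\<Sum>j<k - 1. diff_integral Pn P0 (grad A (j + 1) (update A (j + 1) P0)) +
                    remainder \<Psi> A (j + 1) (update A (j + 1) P0) P0)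
        + diff_integral Pn P0 (grad A k (update A k (initial A)))
        + remainder \<Psi> A k (update A k (initial A)) P0
        - (\<Sum>j<k - 1. \<integral>y. grad A (j + 1) (update A (j + 1) P0) y \<partial>Pn)
        - (\<integral>y. grad A k (update A k (initial A)) y \<partial>Pn))
     \<and>
     (\<forall>J\<subseteq>{1..k}. let M = (\<lambda>j. if j \<in> J then hal A else Pn) in
      \<Psi> (kth_order_tmle A k) - \<Psi> P0 =
        (\<Sum>j<k - 1. diff_integral (M (j + 1)) P0 (grad A (j + 1) (update A (j + 1) P0)) +
                    remainder \<Psi> A (j + 1) (update A (j + 1) P0) P0)
        + diff_integral (M k) P0 (grad A k (update A k (initial A)))
        + remainder \<Psi> A k (update A k (initial A)) P0
        - (\<Sum>j<k - 1. \<integral>y. grad A (j + 1) (update A (j + 1) P0) y \<partial>M (j + 1))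
        - (\<integral>y. grad A k (update A k (initial A)) y \<partial>M k))
     \<and>
     (2 \<le> k \<longrightarrow>
      (\<forall>j\<in>{1..k - 1}. solves_score_equation A j P0) \<and> solves_score_equation A k (initial A) \<longrightarrow>
      score_residual A P0 k = 0)
     \<and>
     (2 \<le> k \<longrightarrow> score_residual A P0 k = 0 \<longrightarrow>
      \<Psi> (kth_order_tmle A k) - \<Psi> P0 =
        diff_integral Pn P0 (D1 (update A 1 P0)) + remainder \<Psi> A 1 (update A 1 P0) P0
        + (\<Sum>j = 1..k - 2. diff_integral (hal A) P0 (grad A (j + 1) (update A (j + 1) P0)) +
                    remainder \<Psi> A (j + 1) (update A (j + 1) P0) P0)
        + diff_integral (hal A) P0 (grad A k (update A k (initial A)))
        + remainder \<Psi> A k (update A k (initial A)) P0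
        + diff_integral (hal A) Pn (D1 (update A 1 P0)))"
proof -
  have expansion_empirical: "\<Psi> (kth_order_tmle A k) - \<Psi> P0 =
        (\<Sum>j<k - 1. diff_integral Pn P0 (grad A (j + 1) (update A (j + 1) P0)) +
                    remainder \<Psi> A (j + 1) (update A (j + 1) P0) P0)
        + diff_integral Pn P0 (grad A k (update A k (initial A)))
        + remainder \<Psi> A k (update A k (initial A)) P0
        - (\<Sum>j<k - 1. \<integral>y. grad A (j + 1) (update A (j + 1) P0) y \<partial>Pn)
        - (\<integral>y. grad A k (update A k (initial A)) y \<partial>Pn)"
    by (rule tmle_expansion [OF k, where M = "\<lambda>_. Pn"])
  have expansion_residual_0: "\<Psi> (kth_order_tmle A k) - \<Psi> P0 =
        diff_integral Pn P0 (D1 (update A 1 P0)) + remainder \<Psi> A 1 (update A 1 P0) P0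
        + (\<Sum>j = 1..k - 2. diff_integral (hal A) P0 (grad A (j + 1) (update A (j + 1) P0)) +
                    remainder \<Psi> A (j + 1) (update A (j + 1) P0) P0)
        + diff_integral (hal A) P0 (grad A k (update A k (initial A)))
        + remainder \<Psi> A k (update A k (initial A)) P0
        + diff_integral (hal A) Pn (D1 (update A 1 P0))"
    if k2: "2 \<le> k" and residual: "score_residual A P0 k = 0"
  proof -
    \<comment> \<open>The gradients of order 1 and \<open>D1\<close> are only known to agree on the model.\<close>
    have "1 \<in> {1..k}" "P0 \<in> update_domain A 1"
      using k2 used(2) by auto
    with tmle(3) have "update A 1 P0 \<in> update_domain A (1 - 1)"
      unfolding ho_tmle_def by blast
    moreover have "update_domain A 0 = laws S" "\<forall>P\<in>laws S. grad A 1 P = D1 P"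
      using tmle(3) unfolding ho_tmle_def by blast+
    ultimately have grad_1: "grad A 1 (update A 1 P0) = D1 (update A 1 P0)"
      by simp
    define t where "t j = diff_integral (hal A) P0 (grad A (j + 1) (update A (j + 1) P0)) +
        remainder \<Psi> A (j + 1) (update A (j + 1) P0) P0" for j
    have "(\<Sum>j<k - 1. \<integral>y. grad A (j + 1) (update A (j + 1) P0) y \<partial>hal A) =
        (\<Sum>j = 1..k - 1. \<integral>y. grad A j (update A j P0) y \<partial>hal A)"
      by (rule sum.reindex_bij_witness [where i = "\<lambda>j. j - 1" and j = Suc]) auto
    then have "\<Psi> (kth_order_tmle A k) - \<Psi> P0 =
        (\<Sum>j<k - 1. t j) + diff_integral (hal A) P0 (grad A k (update A k (initial A)))
        + remainder \<Psi> A k (update A k (initial A)) P0"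
      using tmle_expansion [OF k, where M = "\<lambda>_. hal A" and \<Psi> = \<Psi> and A = A and ?P0.0 = P0] residual
      unfolding t_def score_residual_def by linarith
    moreover have "(\<Sum>j<k - 1. t j) = t 0 + (\<Sum>j = 1..k - 2. t j)"
    proof -
      have "{..<k - 1} = insert 0 {1..k - 2}"
        using k2 by auto
      then show ?thesis
        by simp
    qed
    moreover have "t 0 = diff_integral Pn P0 (D1 (update A 1 P0)) + remainder \<Psi> A 1 (update A 1 P0) P0
        + diff_integral (hal A) Pn (D1 (update A 1 P0))"
      unfolding t_def add_0 grad_1 diff_integral_def by simp
    ultimately show ?thesis
      unfolding t_def by linarith
  qed
  have expansion_replaced: "\<forall>J\<subseteq>{1..k}. let M = (\<lambda>j. if j \<in> J then hal A else Pn) in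
      \<Psi> (kth_order_tmle A k) - \<Psi> P0 =
        (\<Sum>j<k - 1. diff_integral (M (j + 1)) P0 (grad A (j + 1) (update A (j + 1) P0)) +
                    remainder \<Psi> A (j + 1) (update A (j + 1) P0) P0)
        + diff_integral (M k) P0 (grad A k (update A k (initial A)))
        + remainder \<Psi> A k (update A k (initial A)) P0
        - (\<Sum>j<k - 1. \<integral>y. grad A (j + 1) (update A (j + 1) P0) y \<partial>M (j + 1))
        - (\<integral>y. grad A k (update A k (initial A)) y \<partial>M k)"
    unfolding Let_def by (intro allI impI tmle_expansion [OF k])
  have "\<Psi> (kth_order_tmle A k) - \<Psi> P0 = \<Psi> (foldr (update A) [1..<Suc k] (initial A)) - \<Psi> P0"
    by (simp only: kth_order_tmle_def)
  then show ?thesis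
    using expansion_empirical expansion_replaced score_residual_eq_0 expansion_residual_0 by blast
qed

end
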